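(* For every integer $h\ge 1$, $$|CI_{2h+1}(4321)|=|CI_{2h+1}(3412)|=|CI_{2h}(4321)|=|CI_{2h}(3412)|=\sum_{i=0}^h \frac{h!}{(h-i)!\,\lfloor\frac{i}{2}\rfloor!\,\lceil\frac{i}{2}\rceil!}.$$
   Context: $CI_n$ is the set of centrosymmetric involutions in the symmetric group $S_n$, i.e. involutions $\tau\in S_n$ with $\tau(i)+\tau(n+1-i)=n+1$ for every $1\le i\le n$. A permutation $\sigma\in S_n$ contains the pattern $\pi\in S_k$ if there are $1\le i_1<\dots<i_k\le n$ such that $(\sigma(i_1),\dots,\sigma(i_k))$ is order-isomorphic to $\pi$; otherwise $\sigma$ avoids $\pi$. $CI_n(\pi)$ denotes the set of elements of $CI_n$ avoiding $\pi$. *)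

theory Defs
  imports Complex_Main "HOL-Combinatorics.Permutations"
begin

(* Elements of S_n are the functions permuting {1..n}, hence fixing every other natural number. *)

definition centrosymmetric_involutions :: "nat \<Rightarrow> (nat \<Rightarrow> nat) set" where
  "centrosymmetric_involutions n =
     {\<tau>. \<tau> permutes {1..n} \<and> \<tau> \<circ> \<tau> = id \<and>
          (\<forall>i\<in>{1..n}. \<tau> i + \<tau> (n + 1 - i) = n + 1)}"

(* A pattern is given in one-line notation, so [4, 3, 2, 1] is the pattern 4321. Positions in
   the list count from 0: the occurrence of the pattern is at indices ix 0 < ... < ix (k - 1). *)

definition contains_pattern :: "nat \<Rightarrow> (nat \<Rightarrow> nat) \<Rightarrow> nat list \<Rightarrow> bool" where
  "contains_pattern n \<sigma> \<pi> \<longleftrightarrow>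
     (\<exists>ix :: nat \<Rightarrow> nat.
        strict_mono_on {..<length \<pi>} ix \<and> ix ` {..<length \<pi>} \<subseteq> {1..n} \<and>
        (\<forall>a<length \<pi>. \<forall>b<length \<pi>. \<sigma> (ix a) < \<sigma> (ix b) \<longleftrightarrow> \<pi> ! a < \<pi> ! b))"

definition CI_avoiding :: "nat \<Rightarrow> nat list \<Rightarrow> (nat \<Rightarrow> nat) set" where
  "CI_avoiding n \<pi> = {\<tau> \<in> centrosymmetric_involutions n. \<not> contains_pattern n \<tau> \<pi>}"

end

theory Submission
  imports Defs
begin

text \<open>
  Draw an involution \<open>\<tau>\<close> as a set of arcs from \<open>a\<close> to \<open>\<tau> a\<close> with \<open>a < \<tau> a\<close>, and read it from
  left to right as a lattice path: an opener \<open>a\<close> is an up step, the closer \<open>\<tau> a\<close> a down step,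
  and a fixed point a flat step. Since every closer comes after its opener, the path stays
  nonnegative and returns to \<open>0\<close>; it is a Motzkin path.

  An involution avoids 4321 exactly if no arc is nested in another, and avoids 3412 exactly if no
  two arcs cross. Either condition says which opener each closer has to be matched with once the
  path is given: the earliest one still open for 4321, the latest one still open for 3412.
  Therefore in both cases an involution is determined by its path, and every Motzkin path occurs
  (\<open>follows_steps_unique\<close>, \<open>follows_steps_exists\<close>). The two arguments differ only in the rule that
  picks the opener, so both are carried out for an abstract rule, the locale \<open>closing_rule\<close>.

  Both patterns equal their own reverse-complement, so conjugation by the reversal of
  \<open>{1..n}\<close> preserves avoidance. It acts on paths as reflection in a vertical line. As the path
  determines the involution, the centrosymmetric avoiders are those with a symmetric path, and
  a symmetric path amounts to its first \<open>h\<close> steps, an arbitrary nonnegative walk from \<open>0\<close>. When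
  \<open>n = 2 * h + 1\<close>, the middle step is its own negative, so it is flat and contributes no choice.
  Hence all four sets have as many elements as \<open>walks h 0\<close> (\<open>card_CI_avoiding\<close>).

  Finally, choose the \<open>i\<close> positions of a walk that are not flat. The remaining up-down walk of length
  \<open>i\<close> stays nonnegative in \<open>i choose (i div 2)\<close> cases, by the reflection principle, which enters
  here as a recursion in the starting height (\<open>updown_walk_count_Suc\<close>). Summing
  \<open>(h choose i) * (i choose (i div 2))\<close> gives the stated formula.
\<close>

section \<open>Involutions with a prescribed sequence of steps\<close>

definition step :: "(nat \<Rightarrow> nat) \<Rightarrow> nat \<Rightarrow> int" where
  "step \<tau> i = sgn (int (\<tau> i) - int i)"

lemma step_eq:
  "step \<tau> i = 1 \<longleftrightarrow> i < \<tau> i" "step \<tau> i = - 1 \<longleftrightarrow> \<tau> i < i" "step \<tau> i = 0 \<longleftrightarrow> \<tau> i = i"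
  by (auto simp: step_def sgn_if)

lemma step_cases: "step \<tau> i \<in> {- 1, 0, 1}"
  by (auto simp: step_def sgn_if)

lemma involution_apply: "\<tau> \<circ> \<tau> = id \<Longrightarrow> \<tau> (\<tau> x) = x"
  by (metis comp_apply id_apply)

lemma sum_steps_eq_card_diff:
  fixes t :: "'a \<Rightarrow> int"
  assumes "finite K" "\<And>i. t i \<in> {- 1, 0, 1}"
  shows "(\<Sum>i\<in>K. t i) = int (card {i\<in>K. t i = 1}) - int (card {i\<in>K. t i = - 1})"
proof -
  have "t i = of_bool (t i = 1) - of_bool (t i = - 1)" for i
    using assms(2)[of i] by auto
  then have "(\<Sum>i\<in>K. t i) = (\<Sum>i\<in>K. of_bool (t i = 1) - of_bool (t i = - 1))"
    by (rule sum.cong[OF refl])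
  then show ?thesis
    using assms(1) by (simp add: sum_subtractf Int_def)
qed

text \<open>Each closer in \<open>{1..k}\<close> has its opener in \<open>{1..k}\<close>, so the map \<open>\<tau>\<close> embeds the down steps among
  the up steps.\<close>

lemma sum_steps_nonneg:
  assumes perm: "\<tau> permutes {1..n}" and inv: "\<tau> \<circ> \<tau> = id"
  shows "0 \<le> (\<Sum>i\<in>{1..k}. step \<tau> i)"
proof -
  note ii = involution_apply[OF inv]
  have "\<tau> 0 = 0"
    using perm by (simp add: permutes_def)
  then have pos: "0 < \<tau> i" if "0 < i" for i
    using ii that by (metis gr0I less_irrefl)
  have "card {i\<in>{1..k}. step \<tau> i = - 1} \<le> card {i\<in>{1..k}. step \<tau> i = 1}"
  proof (rule card_inj_on_le)
    show "inj_on \<tau> {i\<in>{1..k}. step \<tau> i = - 1}"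
      using ii by (metis inj_on_inverseI)
    show "\<tau> ` {i\<in>{1..k}. step \<tau> i = - 1} \<subseteq> {i\<in>{1..k}. step \<tau> i = 1}"
      using ii pos by (auto simp: step_eq Suc_le_eq)
  qed simp
  then show ?thesis
    by (subst sum_steps_eq_card_diff) (use step_cases in auto)
qed

text \<open>The relation \<open>prec b a c\<close> means that, at the closer \<open>b\<close>, the opener \<open>a\<close> has priority over
  \<open>c\<close>. Openers to the right of \<open>b\<close> are not available yet, and asymmetry is therefore demanded only
  to the left of \<open>b\<close>; allowing \<open>prec b a c\<close> for \<open>c\<close> beyond \<open>b\<close> makes it possible to express
  that such an arc is harmless.\<close>

locale closing_rule =
  fixes prec :: "nat \<Rightarrow> nat \<Rightarrow> nat \<Rightarrow> bool"
  assumes prec_asym: "a < b \<Longrightarrow> c < b \<Longrightarrow> prec b a c \<Longrightarrow> \<not> prec b c a"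
    and prec_first: "finite A \<Longrightarrow> x \<in> A \<Longrightarrow> x < b \<Longrightarrow>
      \<exists>a\<in>A. a < b \<and> (\<forall>c\<in>A - {a}. prec b a c)"
begin

definition follows :: "(nat \<Rightarrow> nat) \<Rightarrow> bool" where
  "follows \<tau> \<longleftrightarrow> (\<forall>b d. \<tau> b < b \<longrightarrow> \<tau> d < d \<longrightarrow> b < d \<longrightarrow> prec b (\<tau> b) (\<tau> d))"

text \<open>By induction on the closer \<open>b\<close>: suppose that \<open>\<tau>\<close> and \<open>\<sigma>\<close> agree on the earlier closers but match
  \<open>b\<close> with different openers \<open>\<tau> b\<close> and \<open>\<sigma> b\<close>. Then each involution closes the other one's
  opener later than \<open>b\<close>, so each of the two openers has priority over the other.\<close>

lemma follows_steps_unique: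
  assumes inv: "\<tau> \<circ> \<tau> = id" "\<sigma> \<circ> \<sigma> = id"
    and rule: "follows \<tau>" "follows \<sigma>"
    and steps: "\<And>i. step \<tau> i = step \<sigma> i"
  shows "\<tau> = \<sigma>"
proof -
  note ii = involution_apply[OF inv(1)] involution_apply[OF inv(2)]
  have up: "x < \<tau> x \<longleftrightarrow> x < \<sigma> x" and down: "\<tau> x < x \<longleftrightarrow> \<sigma> x < x" for x
    using steps[of x] step_eq by metis+
  have "\<tau> b < b \<Longrightarrow> \<tau> b = \<sigma> b" for b
  proof (induction b rule: less_induct)
    case (less b)
    have \<sigma>b: "\<sigma> b < b"
      using less.prems down by blast
    show ?case
    proof (rule ccontr)
      assume neq: "\<tau> b \<noteq> \<sigma> b"
      have d: "\<tau> (\<sigma> b) > b"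
      proof (rule ccontr)
        assume "\<not> \<tau> (\<sigma> b) > b"
        moreover have "\<tau> (\<sigma> b) \<noteq> b" using neq ii by metis
        ultimately have lt: "\<tau> (\<sigma> b) < b" by simp
        have "\<sigma> b < \<tau> (\<sigma> b)" using \<sigma>b ii up by metis
        with less.IH[OF lt] have "\<sigma> b = \<sigma> (\<tau> (\<sigma> b))" using ii by simp
        then show False using ii lt by (metis less_irrefl)
      qed
      have e: "\<sigma> (\<tau> b) > b"
      proof (rule ccontr)
        assume "\<not> \<sigma> (\<tau> b) > b"
        moreover have "\<sigma> (\<tau> b) \<noteq> b" using neq ii by metis
        ultimately have lt: "\<sigma> (\<tau> b) < b" by simp
        have "\<tau> b < \<sigma> (\<tau> b)" using less.prems ii up by metis
        with less.IH[OF lt] have "\<tau> (\<sigma> (\<tau> b)) = \<tau> b" using ii down by simp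
        then show False using ii lt by (metis less_irrefl)
      qed
      have "prec b (\<tau> b) (\<sigma> b)"
        using rule(1) less.prems d \<sigma>b ii unfolding follows_def by (metis less_trans)
      moreover have "prec b (\<sigma> b) (\<tau> b)"
        using rule(2) less.prems e \<sigma>b ii unfolding follows_def by (metis less_trans)
      ultimately show False using prec_asym less.prems \<sigma>b by blast
    qed
  qed
  then have closers: "\<tau> b < b \<Longrightarrow> \<tau> b = \<sigma> b" for b .
  have "\<tau> x = \<sigma> x" for x
  proof (cases x "\<tau> x" rule: linorder_cases)
    case less
    then show ?thesis using closers[of "\<tau> x"] ii by metis
  next
    case equal
    then show ?thesis using steps[of x] step_eq by metis
  next
    case greater
    then show ?thesis using closers by blast
  qed
  then show ?thesis by blast
qed

text \<open>Match the least closer with the opener of highest priority and delete both. The ballot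
  condition survives: up to any bound from the deleted closer on, both counts drop by one, and
  below it there are no closers. The deleted arc respects the rule against all later arcs by its
  priority, and it is never the later of two arcs since its closer is least.\<close>

lemma follows_exists:
  assumes "finite A" "finite B" "A \<inter> B = {}" "card A = card B"
    and "\<And>k. card {i\<in>B. i \<le> k} \<le> card {i\<in>A. i \<le> k}"
  shows "\<exists>\<tau>. \<tau> \<circ> \<tau> = id \<and> {i. i < \<tau> i} = A \<and> {i. \<tau> i < i} = B \<and> follows \<tau>"
  using assms
proof (induction "card B" arbitrary: A B)
  case 0
  then show ?case by (intro exI[of _ id]) (auto simp: follows_def)
next
  case (Suc m)
  define b where "b = Min B"
  have "B \<noteq> {}" using Suc.hyps(2) by auto
  then have bB: "b \<in> B" and bmin: "\<And>d. d \<in> B \<Longrightarrow> b \<le> d"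
    using Suc.prems(2) by (auto simp: b_def)
  have "{i\<in>B. i \<le> b} \<noteq> {}" using bB by auto
  then have "card {i\<in>B. i \<le> b} \<noteq> 0" using Suc.prems(2) by simp
  then have "card {i\<in>A. i \<le> b} \<noteq> 0" using Suc.prems(5)[of b] by linarith
  then have "{i\<in>A. i \<le> b} \<noteq> {}" by (metis card.empty)
  then obtain x where "x \<in> A" "x \<le> b" by blast
  moreover have "x \<noteq> b" using \<open>x \<in> A\<close> bB Suc.prems(3) by blast
  ultimately obtain a where a: "a \<in> A" "a < b" and afirst: "\<And>c. c \<in> A - {a} \<Longrightarrow> prec b a c"
    using prec_first[of A x b] Suc.prems(1) by auto
  have ballot: "card {i\<in>B - {b}. i \<le> k} \<le> card {i\<in>A - {a}. i \<le> k}" for k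
  proof (cases "b \<le> k")
    case True
    have "{i\<in>B - {b}. i \<le> k} = {i\<in>B. i \<le> k} - {b}" "{i\<in>A - {a}. i \<le> k} = {i\<in>A. i \<le> k} - {a}"
      by auto
    then show ?thesis
      using Suc.prems(1,2,5) True a bB by (simp add: diff_le_mono)
  next
    case False
    then have "{i\<in>B - {b}. i \<le> k} = {}" using bmin by fastforce
    then show ?thesis by (metis card.empty le0)
  qed
  have "\<exists>\<tau>. \<tau> \<circ> \<tau> = id \<and> {i. i < \<tau> i} = A - {a} \<and> {i. \<tau> i < i} = B - {b} \<and> follows \<tau>"
    by (rule Suc.hyps(1)) (use Suc.prems Suc.hyps(2) a bB ballot in auto)
  then obtain \<tau> where \<tau>: "\<tau> \<circ> \<tau> = id" "{i. i < \<tau> i} = A - {a}" "{i. \<tau> i < i} = B - {b}" "follows \<tau>"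
    by blast
  note ii = involution_apply[OF \<tau>(1)]
  have up: "i < \<tau> i \<longleftrightarrow> i \<in> A - {a}" and down: "\<tau> i < i \<longleftrightarrow> i \<in> B - {b}" for i
    using \<tau>(2,3) by blast+
  have ab: "\<tau> a = a" "\<tau> b = b"
    using up[of a] down[of a] up[of b] down[of b] a bB Suc.prems(3) by (auto simp: not_less)
  define \<sigma> where "\<sigma> = \<tau>(a := b, b := a)"
  have val: "\<sigma> a = b" "\<sigma> b = a" "\<And>i. i \<noteq> a \<Longrightarrow> i \<noteq> b \<Longrightarrow> \<sigma> i = \<tau> i"
    using a by (auto simp: \<sigma>_def)
  have up': "i < \<sigma> i \<longleftrightarrow> i \<in> A" and down': "\<sigma> i < i \<longleftrightarrow> i \<in> B" for i
    using up[of i] down[of i] val a bB Suc.prems(3) 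
    by (cases "i = a"; cases "i = b"; auto)+
  have "\<sigma> (\<sigma> i) = i" for i
    using ii ab val by metis
  moreover have "follows \<sigma>"
    unfolding follows_def
  proof (intro allI impI)
    fix c d assume cd: "\<sigma> c < c" "\<sigma> d < d" "c < d"
    have "c \<in> B" "d \<in> B" using cd down' by auto
    then have "d \<noteq> b" "d \<noteq> a" "c \<noteq> a" using bmin cd(3) a Suc.prems(3) by fastforce+
    then have \<sigma>d: "\<sigma> d = \<tau> d" "\<tau> d < d" using val cd by auto
    show "prec c (\<sigma> c) (\<sigma> d)"
    proof (cases "c = b")
      case True
      have "\<tau> d \<in> A - {a}" using up[of "\<tau> d"] ii \<sigma>d(2) by simp
      then show ?thesis using True val \<sigma>d afirst by simp
    next
      case False
      then have "\<sigma> c = \<tau> c" using val \<open>c \<noteq> a\<close> by simp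
      then show ?thesis using \<tau>(4) cd \<sigma>d unfolding follows_def by metis
    qed
  qed
  ultimately show ?case
    using up' down' by (intro exI[of _ \<sigma>]) auto
qed

text \<open>The same for a step sequence instead of a pair of sets: partial sums are differences of the
  numbers of openers and closers.\<close>

lemma follows_steps_exists:
  fixes t :: "nat \<Rightarrow> int"
  assumes vals: "\<And>i. t i \<in> {- 1, 0, 1}"
    and outside: "\<And>i. i \<notin> {1..n} \<Longrightarrow> t i = 0"
    and total: "(\<Sum>i\<in>{1..n}. t i) = 0"
    and ballot: "\<And>k. k \<le> n \<Longrightarrow> 0 \<le> (\<Sum>i\<in>{1..k}. t i)"
  shows "\<exists>\<tau>. \<tau> \<circ> \<tau> = id \<and> (\<forall>i. step \<tau> i = t i) \<and> follows \<tau>"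
proof -
  define A where "A = {i. t i = 1}"
  define B where "B = {i. t i = - 1}"
  have nonzero: "i \<in> {1..n}" if "t i \<noteq> 0" for i
    using outside that by blast
  have sub: "A \<subseteq> {1..n}" "B \<subseteq> {1..n}"
    unfolding A_def B_def by (rule subsetI, rule nonzero, simp)+
  have restr: "{i\<in>A. i \<le> k} = {i\<in>{1..min k n}. t i = 1}" 
     "{i\<in>B. i \<le> k} = {i\<in>{1..min k n}. t i = - 1}" for k
    using sub by (auto simp: A_def B_def)
  have all: "A = {i\<in>{1..n}. t i = 1}" "B = {i\<in>{1..n}. t i = - 1}"
    using sub by (auto simp: A_def B_def)
  have "card {i\<in>B. i \<le> k} \<le> card {i\<in>A. i \<le> k}" for k
    using ballot[of "min k n"] sum_steps_eq_card_diff[of "{1..min k n}" t, OF _ vals]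
    by (simp add: restr)
  moreover have "card A = card B"
    using total sum_steps_eq_card_diff[of "{1..n}" t, OF _ vals] all by simp
  moreover have "finite A" "finite B" "A \<inter> B = {}"
    using sub finite_subset by (auto simp: A_def B_def)
  ultimately obtain \<tau> where \<tau>: "\<tau> \<circ> \<tau> = id" "{i. i < \<tau> i} = A" "{i. \<tau> i < i} = B" "follows \<tau>"
    using follows_exists[of A B] by blast
  have "step \<tau> i = t i" for i
  proof -
    have "step \<tau> i = 1 \<longleftrightarrow> t i = 1" "step \<tau> i = - 1 \<longleftrightarrow> t i = - 1"
      using \<tau>(2,3) by (auto simp: step_eq A_def B_def)
    then show ?thesis using step_cases[of \<tau> i] vals[of i] by auto
  qed
  then show ?thesis using \<tau> by blast
qed

end


section \<open>Centrosymmetric involutions as half words\<close>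

text \<open>Points outside \<open>{1..n}\<close> are fixed so that conjugation maps permutations of \<open>{1..n}\<close> to
  permutations of \<open>{1..n}\<close>.\<close>

definition reversal :: "nat \<Rightarrow> nat \<Rightarrow> nat" where
  "reversal n i = (if i \<in> {1..n} then n + 1 - i else i)"

lemma reversal_reversal [simp]: "reversal n (reversal n i) = i"
  by (auto simp: reversal_def)

lemma reversal_in: "i \<in> {1..n} \<Longrightarrow> reversal n i \<in> {1..n}"
  by (auto simp: reversal_def)

lemma reversal_less_iff:
  "i \<in> {1..n} \<Longrightarrow> j \<in> {1..n} \<Longrightarrow> reversal n i < reversal n j \<longleftrightarrow> j < i"
  by (auto simp: reversal_def)

lemma step_reversal_conj:
  assumes "\<tau> permutes {1..n}" and i: "i \<in> {1..n}"
  shows "step (reversal n \<circ> \<tau> \<circ> reversal n) i = - step \<tau> (reversal n i)"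
proof -
  have "\<tau> (reversal n i) \<in> {1..n}"
    using permutes_in_image[OF assms(1)] reversal_in[OF i] by blast
  then have "int (reversal n (\<tau> (reversal n i))) - int i = - (int (\<tau> (reversal n i)) - int (reversal n i))"
    using i by (auto simp: reversal_def)
  then show ?thesis
    unfolding step_def comp_apply by (auto simp: sgn_if)
qed

text \<open>The assumption on \<open>\<pi>\<close> says that \<open>\<pi>\<close> is order-isomorphic to its own reverse-complement. Reading an
  occurrence backwards through the reversal then gives an occurrence again.\<close>

lemma contains_pattern_reverse_complement:
  assumes sym: "\<And>a b. a < length \<pi> \<Longrightarrow> b < length \<pi> \<Longrightarrow>
      \<pi> ! a < \<pi> ! b \<longleftrightarrow> \<pi> ! (length \<pi> - 1 - b) < \<pi> ! (length \<pi> - 1 - a)"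
    and perm: "\<sigma> permutes {1..n}"
    and cont: "contains_pattern n (reversal n \<circ> \<sigma> \<circ> reversal n) \<pi>"
  shows "contains_pattern n \<sigma> \<pi>"
proof -
  define k where "k = length \<pi>"
  obtain ix where mono: "strict_mono_on {..<k} ix" and range: "ix ` {..<k} \<subseteq> {1..n}"
    and ord: "\<And>a b. a < k \<Longrightarrow> b < k \<Longrightarrow>
      reversal n (\<sigma> (reversal n (ix a))) < reversal n (\<sigma> (reversal n (ix b))) \<longleftrightarrow> \<pi> ! a < \<pi> ! b"
    using cont unfolding contains_pattern_def k_def by auto
  define ix' where "ix' a = reversal n (ix (k - 1 - a))" for a
  have inr: "ix a \<in> {1..n}" if "a < k" for a
    using range that by auto
  have inr': "ix' a \<in> {1..n}" "\<sigma> (ix' a) \<in> {1..n}" if "a < k" for a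
  proof -
    show "ix' a \<in> {1..n}"
      unfolding ix'_def by (rule reversal_in, rule inr) (use that in simp)
    then show "\<sigma> (ix' a) \<in> {1..n}"
      using permutes_in_image[OF perm] by blast
  qed
  have "strict_mono_on {..<k} ix'"
  proof (rule strict_mono_onI)
    fix a b assume "a \<in> {..<k}" "b \<in> {..<k}" "a < b"
    then have "ix (k - 1 - b) < ix (k - 1 - a)"
      by (intro strict_mono_onD[OF mono]) auto
    then show "ix' a < ix' b"
      using \<open>a \<in> {..<k}\<close> \<open>b \<in> {..<k}\<close> inr by (simp add: ix'_def reversal_less_iff)
  qed
  moreover have "ix' ` {..<k} \<subseteq> {1..n}"
    using inr' by blast
  moreover have "\<sigma> (ix' a) < \<sigma> (ix' b) \<longleftrightarrow> \<pi> ! a < \<pi> ! b" if "a < k" "b < k" for a b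
  proof -
    have "\<sigma> (ix' a) < \<sigma> (ix' b) \<longleftrightarrow> reversal n (\<sigma> (ix' b)) < reversal n (\<sigma> (ix' a))"
      using inr' that by (simp add: reversal_less_iff)
    also have "\<dots> \<longleftrightarrow> \<pi> ! (k - 1 - b) < \<pi> ! (k - 1 - a)"
      using ord[of "k - 1 - b" "k - 1 - a"] that by (simp add: ix'_def)
    also have "\<dots> \<longleftrightarrow> \<pi> ! a < \<pi> ! b"
      using sym[of a b] that unfolding k_def by blast
    finally show ?thesis .
  qed
  ultimately show ?thesis
    unfolding contains_pattern_def k_def by blast
qed

text \<open>The start height \<open>k\<close> may be negative; then there are no walks, because of the case \<open>j = 0\<close>.
  This is what a recursion on the first step requires.\<close>

definition walks :: "nat \<Rightarrow> int \<Rightarrow> int list set" where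
  "walks m k = {w. length w = m \<and> set w \<subseteq> {- 1, 0, 1} \<and> (\<forall>j\<le>m. 0 \<le> k + sum_list (take j w))}"

definition half_word :: "nat \<Rightarrow> (nat \<Rightarrow> nat) \<Rightarrow> int list" where
  "half_word h \<tau> = map (step \<tau>) [1..<h + 1]"

lemma sum_list_take_map_upt:
  "j \<le> h \<Longrightarrow> sum_list (take j (map f [1..<h + 1])) = (\<Sum>i\<in>{1..j}. f i)" for f :: "nat \<Rightarrow> int"
  by (simp add: take_map take_upt interv_sum_list_conv_sum_set_nat atLeastLessThanSuc_atLeastAtMost
      del: upt_Suc)

lemma centrosymmetric_step:
  assumes "\<tau> \<in> centrosymmetric_involutions n" "i \<in> {1..n}"
  shows "step \<tau> (n + 1 - i) = - step \<tau> i"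
proof -
  have "\<tau> i + \<tau> (n + 1 - i) = n + 1"
    using assms by (auto simp: centrosymmetric_involutions_def)
  then have "int (\<tau> (n + 1 - i)) - int (n + 1 - i) = - (int (\<tau> i) - int i)"
    using assms(2) by auto
  then show ?thesis
    unfolding step_def by (auto simp: sgn_if)
qed

text \<open>Steps at mirrored positions are opposite, so the left half gives the right half, and a middle
  position, where the step is its own negative, is fixed.\<close>

lemma half_word_determines_steps:
  assumes n: "n = 2 * h \<or> n = 2 * h + 1"
    and \<tau>: "\<tau> \<in> centrosymmetric_involutions n" and \<sigma>: "\<sigma> \<in> centrosymmetric_involutions n"
    and eq: "half_word h \<tau> = half_word h \<sigma>"
  shows "step \<tau> i = step \<sigma> i"
proof -
  have low: "step \<tau> i = step \<sigma> i" if "i \<in> {1..h}" for i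
    using eq that by (auto simp: half_word_def simp del: upt_Suc)
  consider "i \<notin> {1..n}" | "i \<in> {1..h}" | "i \<in> {1..n}" "n + 1 - i \<in> {1..h}" 
    | "i \<in> {1..n}" "n + 1 - i = i"
    using n by force
  then show ?thesis
  proof cases
    case 1
    then have "\<tau> i = i" "\<sigma> i = i"
      using \<tau> \<sigma> by (auto simp: centrosymmetric_involutions_def permutes_def)
    then show ?thesis by (simp add: step_def)
  next
    case 2
    then show ?thesis by (rule low)
  next
    case 3
    then show ?thesis
      using low[of "n + 1 - i"] centrosymmetric_step[OF \<tau>, of i] centrosymmetric_step[OF \<sigma>, of i]
      by simp
  next
    case 4
    then show ?thesis
      using centrosymmetric_step[OF \<tau>, of i] centrosymmetric_step[OF \<sigma>, of i] by simp
  qed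
qed

lemma half_word_in_walks:
  assumes "\<tau> \<in> centrosymmetric_involutions n"
  shows "half_word h \<tau> \<in> walks h 0"
proof -
  have "0 \<le> sum_list (take j (half_word h \<tau>))" if "j \<le> h" for j
    using sum_steps_nonneg[of \<tau> n j] assms sum_list_take_map_upt[OF that, of "step \<tau>"]
    by (auto simp: half_word_def centrosymmetric_involutions_def)
  then show ?thesis
    using step_cases by (auto simp: walks_def half_word_def)
qed

text \<open>The step sequence of a symmetric path is antisymmetric, so the height before the last
  \<open>k\<close> steps is the height after the first \<open>k\<close>; nonnegativity has to be checked on one half only.\<close>

lemma sum_antisymmetric:
  fixes t :: "nat \<Rightarrow> int"
  assumes anti: "\<And>i. i \<in> {1..n} \<Longrightarrow> t (n + 1 - i) = - t i" and "k \<le> n"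
  shows "(\<Sum>i\<in>{1..n}. t i) = 0" "(\<Sum>i\<in>{1..k}. t i) = (\<Sum>i\<in>{1..n - k}. t i)"
proof -
  have flip: "(\<Sum>i\<in>{k + 1..n}. t i) = - (\<Sum>i\<in>{1..n - k}. t i)" if "k \<le> n" for k
  proof -
    have "(\<Sum>i\<in>{k + 1..n}. t i) = (\<Sum>i\<in>{1..n - k}. t (n + 1 - i))"
      by (rule sum.reindex_bij_witness[of _ "\<lambda>i. n + 1 - i" "\<lambda>i. n + 1 - i"]) (use that in auto)
    also have "\<dots> = (\<Sum>i\<in>{1..n - k}. - t i)"
      by (rule sum.cong) (use anti in auto)
    finally show ?thesis by (simp add: sum_negf)
  qed
  show total: "(\<Sum>i\<in>{1..n}. t i) = 0"
    using flip[of 0] by simp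
  have "{1..n} = {1..k} \<union> {k + 1..n}"
    using \<open>k \<le> n\<close> by auto
  then have "(\<Sum>i\<in>{1..n}. t i) = (\<Sum>i\<in>{1..k}. t i) + (\<Sum>i\<in>{k + 1..n}. t i)"
    by (simp add: sum.union_disjoint)
  then show "(\<Sum>i\<in>{1..k}. t i) = (\<Sum>i\<in>{1..n - k}. t i)"
    using total flip[OF \<open>k \<le> n\<close>] by simp
qed

text \<open>A pattern whose avoidance by involutions is governed by a closing rule, and which is invariant
  under reverse-complement.\<close>

locale pattern_closing_rule = closing_rule +
  fixes \<pi> :: "nat list"
  assumes pattern_sym: "\<And>a b. a < length \<pi> \<Longrightarrow> b < length \<pi> \<Longrightarrow>
      \<pi> ! a < \<pi> ! b \<longleftrightarrow> \<pi> ! (length \<pi> - 1 - b) < \<pi> ! (length \<pi> - 1 - a)"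
    and avoids_iff_follows: "\<And>n \<tau>. \<tau> permutes {1..n} \<Longrightarrow> \<tau> \<circ> \<tau> = id \<Longrightarrow>
      \<not> contains_pattern n \<tau> \<pi> \<longleftrightarrow> follows \<tau>"
begin

lemma follows_reversal_conj:
  assumes \<tau>: "\<tau> permutes {1..n}" "\<tau> \<circ> \<tau> = id" "follows \<tau>"
  defines "\<sigma> \<equiv> reversal n \<circ> \<tau> \<circ> reversal n"
  shows "\<sigma> permutes {1..n}" "\<sigma> \<circ> \<sigma> = id" "follows \<sigma>"
proof -
  have val: "\<sigma> i = reversal n (\<tau> (reversal n i))" for i
    by (simp add: \<sigma>_def)
  show inv: "\<sigma> \<circ> \<sigma> = id"
    using involution_apply[OF \<tau>(2)] by (auto simp: val)
  have "\<sigma> i = i" if "i \<notin> {1..n}" for i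
  proof -
    have "\<tau> i = i" using \<tau>(1) that by (meson permutes_not_in)
    then show ?thesis using that by (auto simp: val reversal_def)
  qed
  then show perm: "\<sigma> permutes {1..n}"
    using involution_apply[OF inv] unfolding permutes_def by metis
  show "follows \<sigma>"
    using contains_pattern_reverse_complement[OF pattern_sym \<tau>(1)] avoids_iff_follows[OF \<tau>(1,2)]
      avoids_iff_follows[OF perm inv] \<tau>(3) by (auto simp: \<sigma>_def)
qed

text \<open>Extend the walk antisymmetrically and take the involution with these steps. It is
  centrosymmetric because its conjugate by the reversal follows the rule with the same
  steps and must therefore coincide with it.\<close>

lemma half_word_surj:
  assumes n: "n = 2 * h \<or> n = 2 * h + 1" and w: "w \<in> walks h 0"
  shows "\<exists>\<tau>\<in>CI_avoiding n \<pi>. half_word h \<tau> = w"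
proof -
  have len: "length w = h" and vals: "set w \<subseteq> {- 1, 0, 1}"
    and prefix: "\<And>j. j \<le> h \<Longrightarrow> 0 \<le> sum_list (take j w)"
    using w by (auto simp: walks_def)
  define t where "t i = (if i \<in> {1..h} then w ! (i - 1)
    else if i \<in> {1..n} \<and> n + 1 - i \<in> {1..h} then - (w ! (n - i)) else 0)" for i
  have letters: "w ! i \<in> {- 1, 0, 1}" if "i < h" for i
    using vals len that nth_mem by blast
  have t_cases: "t i \<in> {- 1, 0, 1}" for i
    using letters[of "i - 1"] letters[of "n - i"] by (auto simp: t_def)
  have anti: "t (n + 1 - i) = - t i" if "i \<in> {1..n}" for i
    using that n by (auto simp: t_def Suc_diff_le)
  have outside: "t i = 0" if "i \<notin> {1..n}" for i
    using that n by (auto simp: t_def)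
  have w_eq: "w = map t [1..<h + 1]"
    by (rule nth_equalityI) (auto simp: len t_def simp del: upt_Suc)
  have low: "0 \<le> (\<Sum>i\<in>{1..k}. t i)" if "k \<le> h" for k
    using prefix[OF that] sum_list_take_map_upt[OF that, of t] unfolding w_eq[symmetric] by simp
  have ballot: "0 \<le> (\<Sum>i\<in>{1..k}. t i)" if "k \<le> n" for k
  proof (cases "k \<le> h")
    case False
    \<comment> \<open>to the right of the middle, the height equals one on the left\<close>
    then have "n - k \<le> h" using n by auto
    then show ?thesis using low sum_antisymmetric(2)[of n t k, OF anti that] by simp
  qed (rule low)
  obtain \<tau> where \<tau>: "\<tau> \<circ> \<tau> = id" "\<And>i. step \<tau> i = t i" "follows \<tau>"
    using follows_steps_exists[of t n, OF t_cases outside sum_antisymmetric(1)[of n t n, OF anti] ballot]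
    by auto
  have "\<tau> i = i" if "i \<notin> {1..n}" for i
    using outside[OF that] \<tau>(2) step_eq(3) by metis
  then have perm: "\<tau> permutes {1..n}"
    using involution_apply[OF \<tau>(1)] unfolding permutes_def by metis
  define \<sigma> where "\<sigma> = reversal n \<circ> \<tau> \<circ> reversal n"
  note \<sigma> = follows_reversal_conj[OF perm \<tau>(1,3), folded \<sigma>_def]
  have "step \<sigma> i = step \<tau> i" for i
  proof (cases "i \<in> {1..n}")
    case True
    then have "step \<sigma> i = - t (reversal n i)"
      using step_reversal_conj[OF perm] \<tau>(2) by (simp add: \<sigma>_def)
    then show ?thesis
      using anti True \<tau>(2) by (simp add: reversal_def)
  next
    case False
    then have "\<sigma> i = i" using \<sigma>(1) by (meson permutes_not_in)
    then show ?thesis using outside[OF False] \<tau>(2) by (simp add: step_def)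
  qed
  then have "\<sigma> = \<tau>"
    by (rule follows_steps_unique[OF \<sigma>(2) \<tau>(1) \<sigma>(3) \<tau>(3)])
  have "\<tau> i + \<tau> (n + 1 - i) = n + 1" if "i \<in> {1..n}" for i
  proof -
    have "\<tau> i = reversal n (\<tau> (reversal n i))"
      using fun_cong[OF \<open>\<sigma> = \<tau>\<close>, of i] by (simp add: \<sigma>_def)
    moreover have "\<tau> (reversal n i) \<in> {1..n}"
      using permutes_in_image[OF perm] reversal_in[OF that] by blast
    ultimately show ?thesis using that by (auto simp: reversal_def)
  qed
  then have "\<tau> \<in> CI_avoiding n \<pi>"
    using perm \<tau>(1,3) avoids_iff_follows[OF perm \<tau>(1)]
    by (auto simp: CI_avoiding_def centrosymmetric_involutions_def)
  moreover have "half_word h \<tau> = w"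
    using w_eq \<tau>(2) by (auto simp: half_word_def)
  ultimately show ?thesis by blast
qed

lemma card_CI_avoiding:
  assumes n: "n = 2 * h \<or> n = 2 * h + 1"
  shows "card (CI_avoiding n \<pi>) = card (walks h 0)"
proof -
  have CI: "\<tau> \<in> CI_avoiding n \<pi> \<Longrightarrow>
      \<tau> \<in> centrosymmetric_involutions n \<and> \<tau> \<circ> \<tau> = id \<and> follows \<tau>" for \<tau>
    using avoids_iff_follows by (auto simp: CI_avoiding_def centrosymmetric_involutions_def)
  have "bij_betw (half_word h) (CI_avoiding n \<pi>) (walks h 0)"
  proof (rule bij_betw_imageI)
    show "inj_on (half_word h) (CI_avoiding n \<pi>)"
      using CI follows_steps_unique half_word_determines_steps[OF n] by (intro inj_onI) metis
    show "half_word h ` CI_avoiding n \<pi> = walks h 0"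
      using CI half_word_in_walks half_word_surj[OF n] by blast
  qed
  then show ?thesis by (rule bij_betw_same_card)
qed

end

section \<open>The patterns 4321 and 3412\<close>

lemma contains_pattern_length4_iff:
  assumes "length \<pi> = 4"
  shows "contains_pattern n \<sigma> \<pi> \<longleftrightarrow>
    (\<exists>p q r s. 1 \<le> p \<and> p < q \<and> q < r \<and> r < s \<and> s \<le> n \<and>
      (\<forall>a<4. \<forall>b<4. \<sigma> ([p, q, r, s] ! a) < \<sigma> ([p, q, r, s] ! b) \<longleftrightarrow> \<pi> ! a < \<pi> ! b))"
proof
  assume "contains_pattern n \<sigma> \<pi>"
  then obtain ix where mono: "strict_mono_on {..<4} ix" and range: "ix ` {..<4} \<subseteq> {1..n}"
    and ord: "\<And>a b. a < 4 \<Longrightarrow> b < 4 \<Longrightarrow> \<sigma> (ix a) < \<sigma> (ix b) \<longleftrightarrow> \<pi> ! a < \<pi> ! b"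
    using assms unfolding contains_pattern_def by auto
  have nth: "[ix 0, ix 1, ix 2, ix 3] ! a = ix a" if "a < 4" for a
    using that by (auto simp: less_Suc_eq numeral_eq_Suc)
  have "ix 0 < ix 1" "ix 1 < ix 2" "ix 2 < ix 3"
    by (rule strict_mono_onD[OF mono]; simp)+
  moreover have "ix 0 \<in> {1..n}" "ix 3 \<in> {1..n}"
    using range by (simp_all add: image_subset_iff)
  then have "1 \<le> ix 0" "ix 3 \<le> n"
    by simp_all
  ultimately show "\<exists>p q r s. 1 \<le> p \<and> p < q \<and> q < r \<and> r < s \<and> s \<le> n \<and>
      (\<forall>a<4. \<forall>b<4. \<sigma> ([p, q, r, s] ! a) < \<sigma> ([p, q, r, s] ! b) \<longleftrightarrow> \<pi> ! a < \<pi> ! b)"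
    using nth ord by (intro exI[of _ "ix 0"] exI[of _ "ix 1"] exI[of _ "ix 2"] exI[of _ "ix 3"]) auto
next
  assume "\<exists>p q r s. 1 \<le> p \<and> p < q \<and> q < r \<and> r < s \<and> s \<le> n \<and>
      (\<forall>a<4. \<forall>b<4. \<sigma> ([p, q, r, s] ! a) < \<sigma> ([p, q, r, s] ! b) \<longleftrightarrow> \<pi> ! a < \<pi> ! b)"
  then obtain p q r s where *: "1 \<le> p" "p < q" "q < r" "r < s" "s \<le> n"
    "\<forall>a<4. \<forall>b<4. \<sigma> ([p, q, r, s] ! a) < \<sigma> ([p, q, r, s] ! b) \<longleftrightarrow> \<pi> ! a < \<pi> ! b"
    by blast
  have "strict_mono_on {..<4} (\<lambda>a. [p, q, r, s] ! a)"
    using *(1-5) by (auto simp: strict_mono_on_def less_Suc_eq numeral_eq_Suc)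
  moreover have "(\<lambda>a. [p, q, r, s] ! a) ` {..<4} \<subseteq> {1..n}"
    using *(1-5) by (auto simp: less_Suc_eq numeral_eq_Suc)
  ultimately show "contains_pattern n \<sigma> \<pi>"
    using *(6) assms unfolding contains_pattern_def
    by (intro exI[of _ "\<lambda>a. [p, q, r, s] ! a"]) auto
qed

lemma contains_4321_iff:
  "contains_pattern n \<sigma> [4, 3, 2, 1] \<longleftrightarrow>
    (\<exists>p q r s. 1 \<le> p \<and> p < q \<and> q < r \<and> r < s \<and> s \<le> n \<and> \<sigma> s < \<sigma> r \<and> \<sigma> r < \<sigma> q \<and> \<sigma> q < \<sigma> p)"
proof -
  have "(\<forall>a<4. \<forall>b<4. \<sigma> ([p, q, r, s] ! a) < \<sigma> ([p, q, r, s] ! b) \<longleftrightarrow>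
      [4, 3, 2, 1] ! a < ([4, 3, 2, 1] ! b :: nat)) \<longleftrightarrow> \<sigma> s < \<sigma> r \<and> \<sigma> r < \<sigma> q \<and> \<sigma> q < \<sigma> p" for p q r s
    by (auto simp: numeral_eq_Suc All_less_Suc2)
  then show ?thesis
    by (simp add: contains_pattern_length4_iff)
qed

lemma contains_3412_iff:
  "contains_pattern n \<sigma> [3, 4, 1, 2] \<longleftrightarrow>
    (\<exists>p q r s. 1 \<le> p \<and> p < q \<and> q < r \<and> r < s \<and> s \<le> n \<and> \<sigma> r < \<sigma> s \<and> \<sigma> s < \<sigma> p \<and> \<sigma> p < \<sigma> q)"
proof -
  have "(\<forall>a<4. \<forall>b<4. \<sigma> ([p, q, r, s] ! a) < \<sigma> ([p, q, r, s] ! b) \<longleftrightarrow>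
      [3, 4, 1, 2] ! a < ([3, 4, 1, 2] ! b :: nat)) \<longleftrightarrow> \<sigma> r < \<sigma> s \<and> \<sigma> s < \<sigma> p \<and> \<sigma> p < \<sigma> q" for p q r s
    by (auto simp: numeral_eq_Suc All_less_Suc2)
  then show ?thesis
    by (simp add: contains_pattern_length4_iff)
qed

lemma moved_in_range:
  assumes "\<tau> permutes {1..n}" "\<tau> i \<noteq> i"
  shows "1 \<le> i \<and> i \<le> n \<and> 1 \<le> \<tau> i \<and> \<tau> i \<le> n"
  using assms permutes_in_image[OF assms(1), of i] permutes_not_in[OF assms(1), of i] by auto

text \<open>A nesting consists of a closer \<open>b\<close> and a later closer whose opener precedes the opener of \<open>b\<close>.
  It is excluded by giving the earliest opener priority.\<close>

interpretation nonnesting: closing_rule "\<lambda>b a c. a < c"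
proof
  fix A :: "nat set" and x b assume "finite A" "x \<in> A" "x < b"
  then have "Min A \<in> A" "Min A \<le> x" "\<forall>c\<in>A - {Min A}. Min A < c"
    by (auto simp: order_less_le intro: Min_in)
  then show "\<exists>a\<in>A. a < b \<and> (\<forall>c\<in>A - {a}. a < c)"
    using \<open>x < b\<close> by (meson order_le_less_trans)
qed auto

text \<open>Two arcs with closers \<open>b < d\<close> do not cross if the opener of \<open>d\<close> comes before that of \<open>b\<close> (the
  arc of \<open>b\<close> is nested) or after \<open>b\<close> (the arcs are disjoint). So the latest opener before \<open>b\<close>
  has priority.\<close>

interpretation noncrossing: closing_rule "\<lambda>b a c. c < a \<or> b \<le> c"
proof
  fix A :: "nat set" and x b assume "finite A" "x \<in> A" "x < b"
  define a where "a = Max {c\<in>A. c < b}"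
  have fin: "finite {c\<in>A. c < b}" and ne: "{c\<in>A. c < b} \<noteq> {}"
    using \<open>finite A\<close> \<open>x \<in> A\<close> \<open>x < b\<close> by auto
  have "a \<in> {c\<in>A. c < b}"
    unfolding a_def by (rule Max_in[OF fin ne])
  moreover have "\<forall>c\<in>{c\<in>A. c < b}. c \<le> a"
    unfolding a_def using Max_ge[OF fin] by blast
  ultimately show "\<exists>a\<in>A. a < b \<and> (\<forall>c\<in>A - {a}. c < a \<or> b \<le> c)"
    by (intro bexI[of _ a]) (auto simp: order_less_le)
qed auto

text \<open>A nesting is an occurrence of 4321 at the four ends of the arcs. Conversely, consider the two
  middle positions \<open>q < r\<close> of an occurrence: if \<open>r\<close> is a closer, then so is the last position, and
  these two arcs are nested; otherwise the first two positions are openers of nested arcs.\<close>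

interpretation nonnesting: pattern_closing_rule "\<lambda>b a c. a < c" "[4, 3, 2, 1]"
proof
  fix n \<tau> assume perm: "\<tau> permutes {1..n::nat}" and inv: "\<tau> \<circ> \<tau> = id"
  note ii = involution_apply[OF inv]
  show "\<not> contains_pattern n \<tau> [4, 3, 2, 1] \<longleftrightarrow> nonnesting.follows \<tau>"
  proof
    assume avoid: "\<not> contains_pattern n \<tau> [4, 3, 2, 1]"
    show "nonnesting.follows \<tau>"
      unfolding nonnesting.follows_def
    proof (intro allI impI, rule ccontr)
      fix b d assume bd: "\<tau> b < b" "\<tau> d < d" "b < d" and "\<not> \<tau> b < \<tau> d"
      moreover have "\<tau> b \<noteq> \<tau> d" using ii bd by (metis less_irrefl)
      ultimately have "\<tau> d < \<tau> b" by simp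
      then have "contains_pattern n \<tau> [4, 3, 2, 1]"
        unfolding contains_4321_iff
        using bd moved_in_range[OF perm, of d] ii
        by (intro exI[of _ "\<tau> d"] exI[of _ "\<tau> b"] exI[of _ b] exI[of _ d]) auto
      then show False using avoid by blast
    qed
  next
    assume "nonnesting.follows \<tau>"
    then have inc: "\<And>b d. \<tau> b < b \<Longrightarrow> \<tau> d < d \<Longrightarrow> b < d \<Longrightarrow> \<tau> b < \<tau> d"
      unfolding nonnesting.follows_def by blast
    show "\<not> contains_pattern n \<tau> [4, 3, 2, 1]"
    proof
      assume "contains_pattern n \<tau> [4, 3, 2, 1]"
      then obtain p q r s where pqrs: "p < q" "q < r" "r < s" "\<tau> s < \<tau> r" "\<tau> r < \<tau> q" "\<tau> q < \<tau> p"
        unfolding contains_4321_iff by blast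
      show False
      proof (cases "\<tau> r < r")
        case True
        then show False using inc[of r s] pqrs by linarith
      next
        case False
        then show False using inc[of "\<tau> q" "\<tau> p"] pqrs ii by simp
      qed
    qed
  qed
qed (auto simp: less_Suc_eq numeral_eq_Suc)

text \<open>A crossing is an occurrence of 3412 at the four ends of the arcs. Conversely, for an occurrence
  at \<open>p < q < r < s\<close>, the arcs opened at \<open>p\<close> and \<open>q\<close> cross if \<open>q < \<tau> p\<close>; otherwise
  \<open>\<tau> r < \<tau> s < \<tau> p \<le> q < r < s\<close>, and the arcs closed at \<open>r\<close> and \<open>s\<close> cross.\<close>

interpretation noncrossing: pattern_closing_rule "\<lambda>b a c. c < a \<or> b \<le> c" "[3, 4, 1, 2]"
proof
  fix n \<tau> assume perm: "\<tau> permutes {1..n::nat}" and inv: "\<tau> \<circ> \<tau> = id"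
  note ii = involution_apply[OF inv]
  show "\<not> contains_pattern n \<tau> [3, 4, 1, 2] \<longleftrightarrow> noncrossing.follows \<tau>"
  proof
    assume avoid: "\<not> contains_pattern n \<tau> [3, 4, 1, 2]"
    show "noncrossing.follows \<tau>"
      unfolding noncrossing.follows_def
    proof (intro allI impI, rule ccontr)
      fix b d assume bd: "\<tau> b < b" "\<tau> d < d" "b < d" and "\<not> (\<tau> d < \<tau> b \<or> b \<le> \<tau> d)"
      moreover have "\<tau> b \<noteq> \<tau> d" using ii bd by (metis less_irrefl)
      ultimately have "\<tau> b < \<tau> d" "\<tau> d < b" by simp_all
      then have "contains_pattern n \<tau> [3, 4, 1, 2]"
        unfolding contains_3412_iff
        using bd moved_in_range[OF perm, of d] moved_in_range[OF perm, of b] ii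
        by (intro exI[of _ "\<tau> b"] exI[of _ "\<tau> d"] exI[of _ b] exI[of _ d]) auto
      then show False using avoid by blast
    qed
  next
    assume "noncrossing.follows \<tau>"
    then have no: "\<And>b d. \<tau> b < b \<Longrightarrow> \<tau> d < d \<Longrightarrow> b < d \<Longrightarrow> \<tau> d < \<tau> b \<or> b \<le> \<tau> d"
      unfolding noncrossing.follows_def by blast
    show "\<not> contains_pattern n \<tau> [3, 4, 1, 2]"
    proof
      assume "contains_pattern n \<tau> [3, 4, 1, 2]"
      then obtain p q r s where pqrs: "p < q" "q < r" "r < s" "\<tau> r < \<tau> s" "\<tau> s < \<tau> p" "\<tau> p < \<tau> q"
        unfolding contains_3412_iff by blast
      show False
      proof (cases "q < \<tau> p")
        case True
        then show False using no[of "\<tau> p" "\<tau> q"] pqrs ii by simp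
      next
        case False
        then show False using no[of r s] pqrs by fastforce
      qed
    qed
  qed
qed (auto simp: less_Suc_eq numeral_eq_Suc)

section \<open>Counting nonnegative walks with flat steps\<close>

text \<open>Pascal's rule in the form that serves two purposes: splitting off one step of an up-down walk
  (\<open>d\<close> counts the down steps) and deciding whether one step of a walk is flat (\<open>d\<close> counts
  the other steps).\<close>

lemma sum_choose_Suc:
  fixes f :: "nat \<Rightarrow> nat"
  shows "(\<Sum>d\<le>Suc i. (Suc i choose d) * f d)
    = (\<Sum>d\<le>i. (i choose d) * f d) + (\<Sum>d\<le>i. (i choose d) * f (Suc d))"
proof -
  have "(\<Sum>d\<le>i. (i choose d) * f d) = (\<Sum>d\<le>Suc i. (i choose d) * f d)"
    by simp
  also have "\<dots> = f 0 + (\<Sum>d\<le>i. (i choose Suc d) * f (Suc d))"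
    by (subst sum.atMost_Suc_shift) simp
  finally show ?thesis
    by (subst sum.atMost_Suc_shift) (simp add: sum.distrib algebra_simps del: sum.atMost_Suc)
qed

text \<open>The number of all walks with \<open>i\<close> steps \<open>1\<close> or \<open>- 1\<close> whose displacement lies between \<open>- k\<close> and
  \<open>k + 1\<close>. By the reflection principle this is the number of such walks from height \<open>k\<close> that stay
  nonnegative: a walk from \<open>k\<close> to a height \<open>e \<ge> 0\<close> that goes below \<open>0\<close> corresponds to a
  walk from \<open>k\<close> to \<open>- 2 - e\<close>, hence with opposite steps to one of displacement \<open>e + k + 2\<close>. Over all
  \<open>e\<close>, the displacements from \<open>- k\<close> on are counted and those from \<open>k + 2\<close> on subtracted.\<close>

definition updown_walk_count :: "nat \<Rightarrow> int \<Rightarrow> nat" where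
  "updown_walk_count i k =
    (\<Sum>d\<le>i. (i choose d) * of_bool (- k \<le> int i - 2 * int d \<and> int i - 2 * int d \<le> k + 1))"

text \<open>A walk with one more step has its displacement in \<open>{- k..k + 1}\<close> if the rest has it in
  \<open>{- k - 1..k}\<close> or \<open>{- k + 1..k + 2}\<close>, according to the step. Exchanging the upper ends of
  these overlapping intervals gives those for the starting heights \<open>k + 1\<close> and \<open>k - 1\<close>. At
  \<open>k = 0\<close> the interval for \<open>k - 1\<close> is empty, as it should be for walks from a negative height.\<close>

lemma updown_walk_count_Suc:
  assumes "0 \<le> k"
  shows "updown_walk_count (Suc i) k = updown_walk_count i (k + 1) + updown_walk_count i (k - 1)"
proof -
  have "of_bool (- k \<le> int (Suc i) - 2 * int d \<and> int (Suc i) - 2 * int d \<le> k + 1)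
      + of_bool (- k \<le> int (Suc i) - 2 * int (Suc d) \<and> int (Suc i) - 2 * int (Suc d) \<le> k + 1)
    = (of_bool (- (k + 1) \<le> int i - 2 * int d \<and> int i - 2 * int d \<le> k + 1 + 1)
      + of_bool (- (k - 1) \<le> int i - 2 * int d \<and> int i - 2 * int d \<le> k - 1 + 1) :: nat)" for d
    using assms by auto
  then show ?thesis
    unfolding updown_walk_count_def sum_choose_Suc
    by (simp only: distrib_left [symmetric] sum.distrib [symmetric])
qed

lemma updown_walk_count_0: "updown_walk_count i 0 = i choose (i div 2)"
proof -
  have "(- 0 \<le> int i - 2 * int d \<and> int i - 2 * int d \<le> 0 + 1) \<longleftrightarrow> d = i div 2" for d
    by auto
  then have "updown_walk_count i 0 = (\<Sum>d\<le>i. if d = i div 2 then i choose d else 0)"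
    unfolding updown_walk_count_def by (intro sum.cong) auto
  then show ?thesis by simp
qed

lemma walks_negative: "k < 0 \<Longrightarrow> walks m k = {}"
  by (auto simp: walks_def)

lemma walks_Suc:
  assumes "0 \<le> k"
  shows "walks (Suc m) k = (\<Union>x\<in>{- 1, 0, 1}. (#) x ` walks m (k + x))" (is "?L = ?R")
proof (intro equalityI subsetI)
  fix w assume w: "w \<in> ?L"
  then obtain x v where xv: "w = x # v" by (auto simp: walks_def length_Suc_conv)
  have "0 \<le> k + x + sum_list (take j v)" if "j \<le> m" for j
    using w that spec[of _ "Suc j"] by (force simp: walks_def xv add.assoc)
  then show "w \<in> ?R" using w by (auto simp: walks_def xv)
next
  fix w assume "w \<in> ?R"
  then obtain x v where xv: "w = x # v" "x \<in> {- 1, 0, 1}" "v \<in> walks m (k + x)" by blast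
  have "0 \<le> k + sum_list (take j w)" if "j \<le> Suc m" for j
    using xv that assms by (cases j) (auto simp: walks_def add.assoc)
  then show "w \<in> ?L" using xv by (auto simp: walks_def)
qed

lemma finite_walks: "finite (walks m k)"
  by (rule finite_subset[OF _ finite_lists_length_eq[of "{- 1, 0, 1 :: int}" m]])
    (auto simp: walks_def)

lemma card_walks_Suc:
  assumes "0 \<le> k"
  shows "card (walks (Suc m) k) = card (walks m k) + (card (walks m (k + 1)) + card (walks m (k - 1)))"
proof -
  have "card (walks (Suc m) k) = (\<Sum>x\<in>{- 1, 0, 1}. card ((#) x ` walks m (k + x)))"
    unfolding walks_Suc[OF assms] by (rule card_UN_disjoint) (auto simp: finite_walks)
  also have "\<dots> = (\<Sum>x\<in>{- 1, 0, 1}. card (walks m (k + x)))"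
    by (intro sum.cong card_image refl) (auto simp: inj_on_def)
  finally show ?thesis by simp
qed

text \<open>The height \<open>- 1\<close>, where both sides vanish, is included because the recursion at height
  \<open>0\<close> refers to it.\<close>

lemma card_walks:
  "- 1 \<le> k \<Longrightarrow> card (walks m k) = (\<Sum>i\<le>m. (m choose i) * updown_walk_count i k)"
proof (induction m arbitrary: k)
  case 0
  have "walks 0 k = (if 0 \<le> k then {[]} else {})"
    by (auto simp: walks_def)
  then show ?case
    by (auto simp: updown_walk_count_def)
next
  case (Suc m)
  show ?case
  proof (cases "0 \<le> k")
    case True
    have "card (walks (Suc m) k) = (\<Sum>i\<le>m. (m choose i) * updown_walk_count i k)
        + (\<Sum>i\<le>m. (m choose i) * updown_walk_count (Suc i) k)"
      using True by (simp add: card_walks_Suc Suc.IH updown_walk_count_Suc distrib_left sum.distrib)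
    then show ?thesis by (simp only: sum_choose_Suc)
  next
    case False
    then have "k = - 1" using Suc.prems by simp
    then have "updown_walk_count i k = 0" for i
      by (simp add: updown_walk_count_def)
    then show ?thesis using False by (simp add: walks_negative)
  qed
qed

lemma card_walks_0: "card (walks h 0) = (\<Sum>i\<le>h. (h choose i) * (i choose (i div 2)))"
  by (simp add: card_walks updown_walk_count_0)

theorem theorem13:
  fixes h :: nat
  assumes "h \<ge> 1"
  shows "card (CI_avoiding (2 * h + 1) [4, 3, 2, 1]) = card (CI_avoiding (2 * h + 1) [3, 4, 1, 2])
    \<and> card (CI_avoiding (2 * h + 1) [3, 4, 1, 2]) = card (CI_avoiding (2 * h) [4, 3, 2, 1])
    \<and> card (CI_avoiding (2 * h) [4, 3, 2, 1]) = card (CI_avoiding (2 * h) [3, 4, 1, 2])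
    \<and> real (card (CI_avoiding (2 * h) [3, 4, 1, 2])) =
        (\<Sum>i = 0..h. fact h /
           (fact (h - i) * fact (nat \<lfloor>real i / 2\<rfloor>) * fact (nat \<lceil>real i / 2\<rceil>)))"
proof -
  have "real ((h choose i) * (i choose (i div 2))) = fact h /
      (fact (h - i) * fact (nat \<lfloor>real i / 2\<rfloor>) * fact (nat \<lceil>real i / 2\<rceil>))" if "i \<le> h" for i
  proof -
    have "nat \<lfloor>real i / 2\<rfloor> = i div 2"
      by linarith
    moreover have "nat \<lceil>real i / 2\<rceil> = i - i div 2"
      by linarith
    ultimately show ?thesis
      using that by (simp add: binomial_fact field_simps)
  qed
  then have "real (card (walks h 0)) = (\<Sum>i = 0..h. fact h /
      (fact (h - i) * fact (nat \<lfloor>real i / 2\<rfloor>) * fact (nat \<lceil>real i / 2\<rceil>)))"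
    by (simp add: card_walks_0 atMost_atLeast0 del: of_nat_mult)
  then show ?thesis
    using nonnesting.card_CI_avoiding[of _ h] noncrossing.card_CI_avoiding[of _ h] by simp
qed

end
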